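(* Let $A(x)=\sum_{n=0}^{\infty}a_nx^n$, $B(x)=\sum_{n=0}^{\infty}b_nx^n$ and $P(x)=\sum_{n=0}^{\infty}p_nx^n$ be formal power series in one variable over $\mathbb{R}$ all of whose coefficients belong to $\mathbb{R}_+=[0,\infty)$. If both compositions $A\circ P$ and $B\circ P$ exist, then the Right Distributive Law holds: the composition $(AB)\circ P$ exists and $$(A\circ P)(B\circ P)=(AB)\circ P.$$
   Context: Formal power series in one variable over $\mathbb{R}$ are identified with sequences of coefficients indexed by $\mathbb{N}_0=\{0,1,2,\ldots\}$. The product of formal power series is the Cauchy product: $(AB)_n=\sum_{j=0}^{n}a_jb_{n-j}$. Powers: $P^0:=1$ (the series with coefficients $1,0,0,\ldots$) and $P^n$ is the $n$-fold Cauchy product of $P$ with itself; $(P^n)_m$ denotes its $m$-th coefficient. The series $P$ is allowed to have nonzero constant term. Composition: $A\circ P$ is said to exist if for every $m\in\mathbb{N}_0$ the series $\sum_{n=0}^{\infty}a_n(P^n)_m$ converges in $\mathbb{R}$; in that case $A\circ P$ is the formal power series with coefficients $(A\circ P)_m:=\sum_{n=0}^{\infty}a_n(P^n)_m$. *)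

theory Defs
  imports Complex_Main "HOL-Computational_Algebra.Formal_Power_Series"
begin

(* The library's fps_compose truncates the inner sum and so describes A o P only when P has
   zero constant term.  Here P is arbitrary and each coefficient of A o P is a genuine
   infinite series of reals. *)

definition compose_exists :: "real fps \<Rightarrow> real fps \<Rightarrow> bool" where
  "compose_exists A P \<longleftrightarrow> (\<forall>m. summable (\<lambda>n. fps_nth A n * fps_nth (P ^ n) m))"

(* Meaningful only under compose_exists A P. *)
definition gcompose :: "real fps \<Rightarrow> real fps \<Rightarrow> real fps" where
  "gcompose A P = Abs_fps (\<lambda>m. \<Sum>n. fps_nth A n * fps_nth (P ^ n) m)"

end

theory Submission
  imports Defs
begin

text \<open>By nonnegativity the series defining the coefficients of \<open>A \<circ> P\<close> and \<open>B \<circ> P\<close> converge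
  absolutely. Hence each product of a coefficient of \<open>A \<circ> P\<close> with one of \<open>B \<circ> P\<close> is the sum of
  the Cauchy product of the two series; adding up the finitely many products that make up the
  \<open>m\<close>-th coefficient and using \<open>P ^ n = P ^ i * P ^ (n - i)\<close> gives the series for \<open>(A * B) \<circ> P\<close>.\<close>

lemma fps_power_nth_nonneg:
  fixes P :: "'a::linordered_idom fps"
  assumes "\<And>n. fps_nth P n \<ge> 0"
  shows "fps_nth (P ^ n) m \<ge> 0"
proof (induction n arbitrary: m)
  case (Suc n)
  then show ?case
    using assms by (auto simp: fps_mult_nth intro!: sum_nonneg)
qed simp

text \<open>For fixed \<open>j\<close>, the inner sum is the \<open>n\<close>-th term of the Cauchy
  product of the series defining the coefficients \<open>j\<close> of \<open>gcompose A P\<close>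
  and \<open>m - j\<close> of \<open>gcompose B P\<close>.\<close>

lemma fps_mult_nth_mult_power_nth:
  fixes A B P :: "'a::comm_ring_1 fps"
  shows "fps_nth (A * B) n * fps_nth (P ^ n) m =
    (\<Sum>j\<le>m. \<Sum>i\<le>n. (fps_nth A i * fps_nth (P ^ i) j) *
      (fps_nth B (n - i) * fps_nth (P ^ (n - i)) (m - j)))"
proof -
  \<comment> \<open>The split point \<open>i\<close> is free, so each summand of the coefficient of
    \<open>A * B\<close> can use its own.\<close>
  have "fps_nth (P ^ n) m = (\<Sum>j\<le>m. fps_nth (P ^ i) j * fps_nth (P ^ (n - i)) (m - j))"
    if "i \<le> n" for i
  proof -
    have "P ^ n = P ^ i * P ^ (n - i)"
      using that by (simp flip: power_add)
    then show ?thesis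
      by (simp add: fps_mult_nth atLeast0AtMost)
  qed
  then have "fps_nth (A * B) n * fps_nth (P ^ n) m =
      (\<Sum>i\<le>n. fps_nth A i * fps_nth B (n - i) *
        (\<Sum>j\<le>m. fps_nth (P ^ i) j * fps_nth (P ^ (n - i)) (m - j)))"
    by (simp add: fps_mult_nth atLeast0AtMost sum_distrib_right)
  also have "\<dots> = (\<Sum>i\<le>n. \<Sum>j\<le>m. (fps_nth A i * fps_nth (P ^ i) j) *
      (fps_nth B (n - i) * fps_nth (P ^ (n - i)) (m - j)))"
    by (simp add: sum_distrib_left mult_ac)
  finally show ?thesis
    by (subst sum.swap)
qed

theorem theorem14:
  fixes A B P :: "real fps"
  assumes "\<And>n. fps_nth A n \<ge> 0"
    and "\<And>n. fps_nth B n \<ge> 0"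
    and "\<And>n. fps_nth P n \<ge> 0"
    and "compose_exists A P"
    and "compose_exists B P"
  shows "compose_exists (A * B) P \<and> gcompose A P * gcompose B P = gcompose (A * B) P"
proof -
  have absA: "summable (\<lambda>n. norm (fps_nth A n * fps_nth (P ^ n) m))" for m
    using assms by (simp add: compose_exists_def fps_power_nth_nonneg)
  have absB: "summable (\<lambda>n. norm (fps_nth B n * fps_nth (P ^ n) m))" for m
    using assms by (simp add: compose_exists_def fps_power_nth_nonneg)
  have sums: "(\<lambda>n. fps_nth (A * B) n * fps_nth (P ^ n) m) sums
      fps_nth (gcompose A P * gcompose B P) m" for m
    unfolding fps_mult_nth_mult_power_nth gcompose_def
    unfolding fps_mult_nth[of "Abs_fps _"] atLeast0AtMost fps_nth_Abs_fps
    \<comment> \<open>Only the finite sum over \<open>j \<le> m\<close> is exchanged with the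
      infinite one.\<close>
    by (intro sums_sum Cauchy_product_sums absA absB)
  then have "compose_exists (A * B) P"
    by (auto simp: compose_exists_def sums_iff)
  moreover have "gcompose A P * gcompose B P = gcompose (A * B) P"
    using sums by (simp add: fps_eq_iff gcompose_def sums_iff)
  ultimately show ?thesis ..
qed

end
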